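(* Let $q_1,q_2\in[e^{-1},1)$. If $q_1<q_2$, then an asymptotic $q_1$-design is uniformly better than an asymptotic $q_2$-design; that is, for all $z\in(0,1]$ $$-q_1\big(\ln(z)-\ln(q_1)\big)\mathbf 1_{(q_1,1]}(z)\ \le\ -q_2\big(\ln(z)-\ln(q_2)\big)\mathbf 1_{(q_2,1]}(z),$$ with strict inequality for at least one $z\in[0,1]$.
   Context: Let $t_0\in(0,1)$ be a change-point and consider the alternative $g_{t_0}(t)=c_0\mathbf 1_{[0,t_0]}(t)+c_1\mathbf 1_{(t_0,1]}(t)$, $t\in[0,1]$, with constants $c_0>c_1$, to the constant regression model. For $q\in(0,1)$, a triangular array of design points $0\le t_{n1}\le\dots\le t_{nn}\le1$, $n\in\mathbb N$, is called an asymptotic $q$-design if $$\lim_{n\to\infty}\frac{\#\{i:1\le i\le n,\ t_{ni}\le t_0\}}{n}=q .$$ An asymptotic $q^*$-design is called uniformly better than an asymptotic $q$-design if for all $z\in(0,1]$ $$-q^*\big(\ln(z)-\ln(q^* )\big)\mathbf 1_{(q^*,1]}(z)\le -q\big(\ln(z)-\ln(q)\big)\mathbf 1_{(q,1]}(z),$$ with "$<$" for at least one $z\in[0,1]$. Here $\mathbf 1_A$ denotes the indicator function of $A$, and the expressions are understood to be $0$ wherever the indicator vanishes (in particular at $z=0$). *)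

theory Defs
  imports Complex_Main "HOL-Library.Indicator_Function"
begin

text \<open>
  A triangular array is a function \<open>t\<close> of which only the values \<open>t n i\<close> with
  \<open>1 \<le> i \<le> n\<close> are relevant.
\<close>

definition design_array :: "(nat \<Rightarrow> nat \<Rightarrow> real) \<Rightarrow> bool" where
  "design_array t \<longleftrightarrow>
     (\<forall>n\<ge>1. (\<forall>i\<in>{1..n}. 0 \<le> t n i \<and> t n i \<le> 1) \<and> mono_on {1..n} (t n))"

definition asymptotic_design :: "real \<Rightarrow> real \<Rightarrow> (nat \<Rightarrow> nat \<Rightarrow> real) \<Rightarrow> bool" where
  "asymptotic_design t0 q t \<longleftrightarrow>
     0 < q \<and> q < 1 \<and> design_array t \<and>
     (\<lambda>n. real (card {i. 1 \<le> i \<and> i \<le> n \<and> t n i \<le> t0}) / real n) \<longlonglongrightarrow> q"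

text \<open>
  At \<open>z = 0\<close> the indicator vanishes for every \<open>q > 0\<close>, so the (total) library value of
  \<open>ln 0\<close> plays no role.
\<close>

definition design_curve :: "real \<Rightarrow> real \<Rightarrow> real" where
  "design_curve q z = - q * (ln z - ln q) * indicat_real {q<..1} z"

text \<open>
  The parameter \<open>q\<close> of an asymptotic \<open>q\<close>-design is a limit, hence determined by the array;
  the existential quantifiers below merely name the parameters of the two designs.
\<close>

definition uniformly_better ::
    "real \<Rightarrow> (nat \<Rightarrow> nat \<Rightarrow> real) \<Rightarrow> (nat \<Rightarrow> nat \<Rightarrow> real) \<Rightarrow> bool" where
  "uniformly_better t0 s t \<longleftrightarrow>
     (\<exists>q' q. asymptotic_design t0 q' s \<and> asymptotic_design t0 q t \<and>
        (\<forall>z\<in>{0<..1}. design_curve q' z \<le> design_curve q z) \<and>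
        (\<exists>z\<in>{0..1}. design_curve q' z < design_curve q z))"

end

theory Submission
  imports Defs
begin

text \<open>Where its indicator is 1, the curve equals \<open>q * ln q - q * ln z\<close>, which is
  negative for \<open>q < z\<close>; elsewhere it is 0. Raising the parameter to \<open>r\<close>
  shortens the negative stretch. Where both curves are active, the gain is
  \<open>(r * ln r - q * ln q) + (r - q) * (- ln z)\<close>. The second summand is nonnegative for
  \<open>z \<le> 1\<close>, the first because \<open>x * ln x\<close> increases from
  \<open>exp (-1)\<close> on (\<open>mult_ln_mono\<close>).\<close>

lemma mult_ln_mono:
  fixes x y :: real
  assumes "exp (-1) \<le> x" and "x \<le> y"
  shows "x * ln x \<le> y * ln y"
proof -
  have x: "0 < x"
    using assms(1) exp_gt_zero[of "-1::real"] by linarith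
  have y: "0 < y"
    using x assms(2) by simp
  \<comment> \<open>The threshold enters here: \<open>ln x + 1\<close>, the derivative of
    \<open>x * ln x\<close>, is nonnegative from \<open>exp (-1)\<close> on.\<close>
  have "ln (exp (-1)) \<le> ln x"
    using assms(1) x by (subst ln_le_cancel_iff) auto
  hence "0 \<le> (y - x) * (ln x + 1)"
    using assms(2) by simp
  moreover have "y - x \<le> y * (ln y - ln x)"
  proof -
    have "ln (x / y) \<le> x / y - 1"
      using x y by (intro ln_le_minus_one) simp
    hence "y * (ln x - ln y) \<le> y * (x / y - 1)"
      using x y by (intro mult_left_mono) (simp_all add: ln_div)
    thus ?thesis
      using y by (simp add: algebra_simps)
  qed
  ultimately show ?thesis
    by (simp add: algebra_simps)
qed

lemma design_curve_mono:
  assumes "exp (-1) \<le> q" and "q \<le> r" and "0 < z"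
  shows "design_curve q z \<le> design_curve r z"
proof -
  have q: "0 < q"
    using assms(1) exp_gt_zero[of "-1::real"] by linarith
  consider "z \<le> q \<or> 1 < z" | "q < z" "z \<le> r" "z \<le> 1" | "r < z" "z \<le> 1"
    by linarith
  then show ?thesis
  proof cases
    case 1
    then show ?thesis
      using assms(2) by (auto simp: design_curve_def)
  next
    case 2
    \<comment> \<open>Only the curve of \<open>q\<close> is active here, and it is negative.\<close>
    then show ?thesis
      using q by (simp add: design_curve_def)
  next
    case 3
    \<comment> \<open>Both curves are active; this is the part of their difference that depends on
      \<open>z\<close>.\<close>
    have "0 \<le> (r - q) * (- ln z)"
      using 3 assms by (intro mult_nonneg_nonneg) simp_all
    with mult_ln_mono[OF assms(1,2)] show ?thesis
      using 3 assms(2) by (simp add: design_curve_def algebra_simps)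
  qed
qed

text \<open>Supplies the witness for strictness. The interval of the indicator is open on the left,
  so at \<open>z = r\<close> the curve of \<open>r\<close> is still 0, while that of
  \<open>q\<close> is already negative.\<close>

lemma design_curve_less:
  assumes "0 < q" and "q < r" and "r \<le> 1"
  shows "design_curve q r < design_curve r r"
  using assms by (simp add: design_curve_def)

theorem theorem5:
  fixes t0 q1 q2 :: real
  assumes "0 < t0" and "t0 < 1"
    and "q1 \<in> {exp (-1)..<1}" and "q2 \<in> {exp (-1)..<1}"
    and "q1 < q2"
  shows "(\<forall>s t. asymptotic_design t0 q1 s \<longrightarrow> asymptotic_design t0 q2 t \<longrightarrow>
            uniformly_better t0 s t) \<and>
         (\<forall>z\<in>{0<..1}. - q1 * (ln z - ln q1) * indicat_real {q1<..1} z
                      \<le> - q2 * (ln z - ln q2) * indicat_real {q2<..1} z) \<and>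
         (\<exists>z\<in>{0..1}. - q1 * (ln z - ln q1) * indicat_real {q1<..1} z
                     < - q2 * (ln z - ln q2) * indicat_real {q2<..1} z)"
proof -
  have "0 < q1"
    using assms(3) exp_gt_zero[of "-1::real"] by (simp only: atLeastLessThan_iff) linarith
  have le: "\<forall>z\<in>{0<..1}. design_curve q1 z \<le> design_curve q2 z"
    using assms by (auto intro: design_curve_mono)
  have less: "\<exists>z\<in>{0..1}. design_curve q1 z < design_curve q2 z"
    using assms \<open>0 < q1\<close> by (intro bexI[of _ q2] design_curve_less) auto
  have "\<forall>s t. asymptotic_design t0 q1 s \<longrightarrow> asymptotic_design t0 q2 t \<longrightarrow> uniformly_better t0 s t"
    using le less unfolding uniformly_better_def by blast
  with le less show ?thesis
    unfolding design_curve_def by blast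
qed

end
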